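(* (Imperfect work extraction.) Consider a work extraction system in which, on observing the measurement $Y=y$, the controller chooses a probability distribution $Q_{X|y}$ of the state $X$, and in which an amount of energy $f(x)$ is lost in each cycle with state $x$ (e.g., due to friction), so that the work extracted in a cycle is $$W=k_BT\ln\frac{Q_{X|Y}(X|Y)}{P_X(X)}-f(X).$$ Then the optimal control protocol (maximizing $E[W|Y=y]$ for each $y$) is still given by $Q^*_{X|y}=P_{X|y}$, and with it $$E[W|Y=y]=k_BT\,D(P_{X|y}||P_X)-E[f(X)|Y=y].$$ However, for some measurement results it may be preferable not to perform the cycle at all: the cycle should be performed only if the measurement result $y$ satisfies $k_BT\,D(P_{X|y}||P_X)>E[f(X)|Y=y]$.
   Context: $X$ is the state of the engine (e.g., the location of a particle), with distribution $P_X$, and $Y$ is a measurement of it; $P_{X|y}$ is the conditional distribution of $X$ given $Y=y$, and $Q_{X|Y}(x|y)=Q_{X|y}(x)$. These are probability mass functions when $X$ is discrete and probability density functions when $X$ is continuous. $k_B$ is the Boltzmann constant and $T$ the temperature of the heat bath. $D(P||Q)=\sum_x P(x)\ln\frac{P(x)}{Q(x)}$ is the Kullback-Leibler divergence (with the sum replaced by an integral for densities). Not performing the cycle extracts no work. *)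

theory Defs
  imports "HOL-Probability.Probability"
begin

(* SX and SY are the reference measures for the densities of the state and of the measurement:
   counting measure on a countable set gives probability mass functions, Lebesgue measure gives
   probability density functions. *)
locale measured_engine =
  prob_space M + SX: sigma_finite_measure SX + SY: sigma_finite_measure SY
  for M :: "'a measure" and SX :: "'x measure" and SY :: "'y measure" +
  fixes X :: "'a \<Rightarrow> 'x" and Y :: "'a \<Rightarrow> 'y"
    and PXY :: "'x \<times> 'y \<Rightarrow> real" and PX :: "'x \<Rightarrow> real" and PY :: "'y \<Rightarrow> real"
  assumes PXY: "distributed M (SX \<Otimes>\<^sub>M SY) (\<lambda>\<omega>. (X \<omega>, Y \<omega>)) PXY"
    and PX: "distributed M SX X PX"
    and PY: "distributed M SY Y PY"
    and PXY_nonneg: "\<And>x y. x \<in> space SX \<Longrightarrow> y \<in> space SY \<Longrightarrow> 0 \<le> PXY (x, y)"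
    and PX_nonneg: "\<And>x. x \<in> space SX \<Longrightarrow> 0 \<le> PX x"
    and PY_nonneg: "\<And>y. y \<in> space SY \<Longrightarrow> 0 \<le> PY y"

definition prob_density :: "'x measure \<Rightarrow> ('x \<Rightarrow> real) \<Rightarrow> bool" where
  "prob_density S q \<longleftrightarrow>
     q \<in> borel_measurable S \<and> (\<forall>x\<in>space S. 0 \<le> q x) \<and> (\<integral>\<^sup>+x. ennreal (q x) \<partial>S) = 1"

definition cond_dens :: "('x \<times> 'y \<Rightarrow> real) \<Rightarrow> ('y \<Rightarrow> real) \<Rightarrow> 'y \<Rightarrow> 'x \<Rightarrow> real" where
  "cond_dens PXY PY y x = PXY (x, y) / PY y"

definition cond_law ::
    "'x measure \<Rightarrow> ('x \<times> 'y \<Rightarrow> real) \<Rightarrow> ('y \<Rightarrow> real) \<Rightarrow> 'y \<Rightarrow> 'x measure" where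
  "cond_law SX PXY PY y = density SX (\<lambda>x. ennreal (cond_dens PXY PY y x))"

(* The mean in the extended reals. It is the usual one unless both parts are infinite, where
   ereal subtraction gives \<infinity>. *)
definition ext_expectation :: "'x measure \<Rightarrow> ('x \<Rightarrow> ereal) \<Rightarrow> ereal" where
  "ext_expectation N g =
     enn2ereal (\<integral>\<^sup>+x. e2ennreal (g x) \<partial>N) - enn2ereal (\<integral>\<^sup>+x. e2ennreal (- g x) \<partial>N)"

(* E[g(X, Y) | Y = y] *)
definition cond_expect ::
    "'x measure \<Rightarrow> ('x \<times> 'y \<Rightarrow> real) \<Rightarrow> ('y \<Rightarrow> real) \<Rightarrow> ('x \<Rightarrow> 'y \<Rightarrow> ereal) \<Rightarrow> 'y \<Rightarrow> ereal" where
  "cond_expect SX PXY PY g y = ext_expectation (cond_law SX PXY PY y) (\<lambda>x. g x y)"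

(* ln 0 = 0 in HOL would make a protocol with Q(x|y) = 0 at possible states look harmless. *)
definition ext_ln :: "real \<Rightarrow> ereal" where
  "ext_ln r = (if 0 < r then ereal (ln r) else -\<infinity>)"

(* D(P || Q). KL_divergence takes the reference law Q first, and is 0 by convention when the
   integral diverges. *)
definition KL :: "'x measure \<Rightarrow> 'x measure \<Rightarrow> ereal" where
  "KL P Q = (if absolutely_continuous Q P \<and> integrable P (entropy_density (exp 1) Q P)
             then ereal (KL_divergence (exp 1) Q P) else \<infinity>)"

(* Q y x is Q(x|y), and f x is the energy lost in a cycle with state x. *)
definition work ::
    "real \<Rightarrow> real \<Rightarrow> ('x \<Rightarrow> real) \<Rightarrow> ('x \<Rightarrow> real) \<Rightarrow> ('y \<Rightarrow> 'x \<Rightarrow> real) \<Rightarrow> 'x \<Rightarrow> 'y \<Rightarrow> ereal" where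
  "work k\<^sub>B T PX f Q x y = ereal (k\<^sub>B * T) * ext_ln (Q y x / PX x) - ereal (f x)"

end

(* For a fixed measurement y write p = P(.|y) and r = P_X, so that the gain of a protocol q splits as
   k T ln (q / r) - f = k T ln (q / p) + (k T ln (p / r) - f). Under p the ratio q / p has mean at
   most 1, and ln t <= t - 1 with equality only at t = 1, so the first summand has nonpositive mean
   (Gibbs), with equality only for q = p. The same bound makes the positive part of ln (q / p) and
   the negative part of ln (p / r) integrable, so the divergence is infinite exactly when the
   optimal gain is. The second part is witnessed by an exactly measured uniform bit for which only
   one of the two states is lossy, at twice the cost k T ln 2 that a cycle can recover. *)
theory Submission
  imports Defs
begin

section \<open>Means in the extended reals and densities of mass one\<close>

lemma ext_expectation_eq_integral:
  assumes h: "integrable N h" and g: "AE x in N. g x = ereal (h x)"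
  shows "ext_expectation N g = ereal (\<integral>x. h x \<partial>N)"
proof -
  have "(\<integral>\<^sup>+x. e2ennreal (g x) \<partial>N) = (\<integral>\<^sup>+x. ennreal (h x) \<partial>N)"
    using g by (intro nn_integral_cong_AE) auto
  moreover have "(\<integral>\<^sup>+x. e2ennreal (- g x) \<partial>N) = (\<integral>\<^sup>+x. ennreal (- h x) \<partial>N)"
    using g by (intro nn_integral_cong_AE) auto
  \<comment> \<open>Integrability makes both parts finite, so the \<open>ereal\<close> difference is
    a difference of reals.\<close>
  moreover obtain a b where "0 \<le> a" "0 \<le> b"
    "(\<integral>\<^sup>+x. ennreal (h x) \<partial>N) = ennreal a" "(\<integral>\<^sup>+x. ennreal (- h x) \<partial>N) = ennreal b"
    using h unfolding real_integrable_def by (metis ennreal_cases infinity_ennreal_def)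
  ultimately show ?thesis
    using h by (simp add: ext_expectation_def real_lebesgue_integral_def enn2ereal_ennreal)
qed

lemma ext_expectation_zero: "ext_expectation N (\<lambda>_. 0) = 0"
  by (simp add: ext_expectation_def e2ennreal_neg)

lemma measurable_ext_ln [measurable]: "ext_ln \<in> borel_measurable borel"
  unfolding ext_ln_def[abs_def] by measurable

lemma prob_density_prob_space: "prob_density S q \<Longrightarrow> prob_space (density S q)"
  by (intro prob_spaceI) (simp add: prob_density_def emeasure_density cong: nn_integral_cong)

text \<open>Where \<open>p\<close> vanishes, \<open>p \<le> q\<close> holds because \<open>q\<close>
  is nonnegative, so it holds almost everywhere; then \<open>q - p\<close> is nonnegative with
  integral 1 - 1 = 0. This carries an equality known only under the law with density
  \<open>p\<close> over to the reference measure.\<close>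

lemma prob_density_eq_of_AE_eq_on_support:
  assumes p: "prob_density S p" and q: "prob_density S q"
    and eq: "AE x in S. 0 < p x \<longrightarrow> q x = p x"
  shows "AE x in S. q x = p x"
proof -
  have [measurable]: "p \<in> borel_measurable S" "q \<in> borel_measurable S"
    using p q by (auto simp: prob_density_def)
  have le: "AE x in S. p x \<le> q x"
    using eq AE_space
  proof eventually_elim
    case (elim x)
    then have "0 \<le> p x" "0 \<le> q x" using p q by (auto simp: prob_density_def)
    with elim show ?case by (cases "p x = 0") auto
  qed
  have "(\<integral>\<^sup>+x. ennreal (q x) - ennreal (p x) \<partial>S) = (\<integral>\<^sup>+x. ennreal (q x) \<partial>S) - (\<integral>\<^sup>+x. ennreal (p x) \<partial>S)"
    using le p by (intro nn_integral_diff) (auto simp: prob_density_def ennreal_leI)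
  then have "(\<integral>\<^sup>+x. ennreal (q x) - ennreal (p x) \<partial>S) = 0"
    using p q by (simp add: prob_density_def)
  then have "AE x in S. ennreal (q x) - ennreal (p x) = 0"
    by (subst (asm) nn_integral_0_iff_AE) auto
  then show ?thesis
    using le AE_space
  proof eventually_elim
    case (elim x)
    then have "0 \<le> p x" "0 \<le> q x" using p q by (auto simp: prob_density_def)
    with elim have "ennreal (q x - p x) = 0" by (simp add: ennreal_minus)
    with elim show ?case by (simp add: ennreal_eq_0_iff)
  qed
qed

section \<open>Log ratios and divergence for a density \<open>p\<close> dominated by
  \<open>r\<close>\<close>

locale dominated_density =
  fixes S :: "'x measure" and p r :: "'x \<Rightarrow> real"
  assumes p: "prob_density S p" and r: "prob_density S r"
    and dominated: "AE x in S. r x = 0 \<longrightarrow> p x = 0"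
begin

abbreviation "P \<equiv> density S (\<lambda>x. ennreal (p x))"
abbreviation "R \<equiv> density S (\<lambda>x. ennreal (r x))"
abbreviation "llr x \<equiv> ln (p x / r x)"

lemma measurable_p [measurable]: "p \<in> borel_measurable S"
  and measurable_r [measurable]: "r \<in> borel_measurable S"
  using p r by (auto simp: prob_density_def)

text \<open>A law puts no mass on the zeros of its own density, and domination then excludes the
  zeros of \<open>r\<close>. Pointwise computations under \<open>P\<close> may therefore take
  logarithms and quotients of \<open>p\<close> and \<open>r\<close>.\<close>

lemma AE_pos: "AE x in P. 0 < p x \<and> 0 < r x"
proof -
  have "AE x in S. 0 < ennreal (p x) \<longrightarrow> 0 < p x \<and> 0 < r x"
    using dominated AE_space
  proof eventually_elim
    case (elim x)
    then have "0 \<le> r x" using r by (auto simp: prob_density_def)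
    with elim show ?case by (cases "r x = 0") auto
  qed
  then show ?thesis by (simp add: AE_density)
qed

text \<open>Weighting \<open>q / p\<close> by \<open>p\<close> returns \<open>q\<close> on the
  support of \<open>p\<close> and 0 elsewhere (division by 0 is 0), so the mean is the mass that
  \<open>q\<close> puts on that support.\<close>

lemma integrable_ratio:
  assumes q: "prob_density S q"
  shows "integrable P (\<lambda>x. q x / p x)" "(\<integral>x. q x / p x \<partial>P) \<le> 1"
proof -
  have [measurable]: "q \<in> borel_measurable S"
    using q by (auto simp: prob_density_def)
  have "(\<integral>\<^sup>+x. ennreal (q x / p x) \<partial>P) = (\<integral>\<^sup>+x. ennreal (p x) * ennreal (q x / p x) \<partial>S)"
    by (simp add: nn_integral_density)
  also have "\<dots> \<le> (\<integral>\<^sup>+x. ennreal (q x) \<partial>S)"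
    using p q
    by (intro nn_integral_mono) (auto simp: prob_density_def ennreal_mult[symmetric] intro!: ennreal_leI)
  finally have le: "(\<integral>\<^sup>+x. ennreal (q x / p x) \<partial>P) \<le> 1"
    using q by (simp add: prob_density_def)
  have nn: "AE x in P. 0 \<le> q x / p x"
    using p q by (intro AE_I2) (auto simp: prob_density_def)
  show int: "integrable P (\<lambda>x. q x / p x)"
    using le nn by (intro integrableI_nonneg) (auto simp: less_top[symmetric] top_unique)
  have "ennreal (\<integral>x. q x / p x \<partial>P) \<le> 1"
    using le nn int by (subst nn_integral_eq_integral[symmetric]) auto
  then show "(\<integral>x. q x / p x \<partial>P) \<le> 1" by (simp add: ennreal_le_1)
qed

text \<open>By ln t \<le> t with t = \<open>r / p\<close>, the negative part of \<open>llr\<close>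
  lies below a function of finite mean, so a failure of integrability can only come from the
  positive part.\<close>

lemma not_integrable_llr:
  assumes "\<not> integrable P llr"
  shows "(\<integral>\<^sup>+x. ennreal (llr x) \<partial>P) = \<infinity>"
proof -
  have "AE x in P. - llr x \<le> r x / p x"
    using AE_pos
  proof eventually_elim
    case (elim x)
    then have "- llr x = ln (r x / p x)" by (simp add: ln_div)
    also have "\<dots> \<le> r x / p x" using elim by (intro ln_bound) auto
    finally show ?case .
  qed
  then have "(\<integral>\<^sup>+x. ennreal (- llr x) \<partial>P) \<le> (\<integral>\<^sup>+x. ennreal (r x / p x) \<partial>P)"
    by (intro nn_integral_mono_AE) (auto intro: ennreal_leI)
  also have "\<dots> < \<infinity>"
    using integrable_ratio(1)[OF r] by (simp add: real_integrable_def less_top)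
  finally show ?thesis
    using assms by (auto simp: real_integrable_def)
qed

text \<open>Domination makes \<open>p / r\<close> a density of \<open>P\<close> with respect to
  \<open>R\<close>, hence the Radon-Nikodym derivative up to an \<open>R\<close>-null set, and
  absolute continuity makes that set \<open>P\<close>-null.\<close>

lemma AE_entropy_density: "AE x in P. entropy_density (exp 1) R P x = llr x"
  and absolutely_continuous: "absolutely_continuous R P"
proof -
  interpret R: prob_space R using r by (rule prob_density_prob_space)
  have "density R (\<lambda>x. ennreal (p x / r x)) = density S (\<lambda>x. ennreal (r x) * ennreal (p x / r x))"
    by (subst density_density_eq) auto
  also have "\<dots> = P"
  proof (intro density_cong)
    \<comment> \<open>Where \<open>r\<close> is 0 the left side is 0, and domination makes
      \<open>p\<close> 0 there too.\<close>
    show "AE x in S. ennreal (r x) * ennreal (p x / r x) = ennreal (p x)"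
      using dominated AE_space
      by eventually_elim (use p r in \<open>auto simp: prob_density_def ennreal_mult[symmetric]\<close>)
  qed auto
  finally have eq: "density R (\<lambda>x. ennreal (p x / r x)) = P" .
  show ac: "absolutely_continuous R P"
    unfolding eq[symmetric] by (intro absolutely_continuousI_density) auto
  have "AE x in R. ennreal (p x / r x) = RN_deriv R P x"
    using eq by (intro R.RN_deriv_unique) auto
  then have "AE x in P. ennreal (p x / r x) = RN_deriv R P x"
    by (rule absolutely_continuous_AE[OF _ ac, rotated]) auto
  with AE_pos show "AE x in P. entropy_density (exp 1) R P x = llr x"
  proof eventually_elim
    case (elim x)
    then have "enn2real (RN_deriv R P x) = p x / r x"
      by (metis enn2real_ennreal divide_nonneg_nonneg less_imp_le)
    then show ?case by (simp add: entropy_density_def log_def)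
  qed
qed

text \<open>Absolute continuity holds for every dominated \<open>p\<close>, so the infinite branch
  of \<open>KL\<close> is reached exactly when \<open>llr\<close> fails to be integrable.\<close>

lemma KL_eq: "KL P R = (if integrable P llr then ereal (\<integral>x. llr x \<partial>P) else \<infinity>)"
proof -
  have [measurable]: "entropy_density (exp 1) R P \<in> borel_measurable P"
    using measurable_entropy_density[of "exp 1" R P] by (simp add: measurable_def)
  have "integrable P (entropy_density (exp 1) R P) \<longleftrightarrow> integrable P llr"
    by (intro integrable_cong_AE AE_entropy_density) auto
  moreover have "KL_divergence (exp 1) R P = (\<integral>x. llr x \<partial>P)"
    unfolding KL_divergence_def by (intro integral_cong_AE AE_entropy_density) auto
  ultimately show ?thesis by (simp add: KL_def absolutely_continuous)
qed

section \<open>Gains of protocols with a loss \<open>f\<close>\<close>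

context
  fixes c :: real and f :: "'x \<Rightarrow> real"
  assumes c: "0 < c" and f [measurable]: "integrable P f"
begin

text \<open>This is \<open>work\<close> at a fixed measurement, with \<open>c\<close> in the role of
  \<open>k\<^sub>B * T\<close> and \<open>r\<close> in the role of \<open>PX\<close>.\<close>

abbreviation "gain q x \<equiv> ereal c * ext_ln (q x / r x) - ereal (f x)"

lemma measurable_f [measurable]: "f \<in> borel_measurable S"
  using borel_measurable_integrable[OF f] by simp

lemma AE_gain_p: "AE x in P. gain p x = ereal (c * llr x - f x)"
  using AE_pos by eventually_elim (auto simp: ext_ln_def)

text \<open>If \<open>llr\<close> is integrable this is linearity of the integral. Otherwise the
  positive part of \<open>llr\<close> has infinite mean, an integrable loss cannot cancel it, and
  both sides are \<infinity>.\<close>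

lemma ext_expectation_gain_p:
  "ext_expectation P (gain p) = ereal c * KL P R - ereal (\<integral>x. f x \<partial>P)"
proof (cases "integrable P llr")
  case True
  then have "integrable P (\<lambda>x. c * llr x - f x)" using f by auto
  from ext_expectation_eq_integral[OF this AE_gain_p] True f show ?thesis
    by (simp add: KL_eq)
next
  case False
  have "\<infinity> = (\<integral>\<^sup>+x. ennreal (llr x) \<partial>P)"
    using not_integrable_llr[OF False] by simp
  \<comment> \<open>Solving the gain for \<open>llr\<close> bounds it by the positive part of the
    gain and the absolute value of \<open>f\<close>; the latter has finite mean, so the former must
    carry the infinite one.\<close>
  also have "\<dots> \<le> (\<integral>\<^sup>+x. ennreal (1 / c) * (e2ennreal (gain p x) + ennreal (norm (f x))) \<partial>P)"
    using AE_gain_p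
  proof (intro nn_integral_mono_AE, eventually_elim)
    case (elim x)
    have "llr x = (1 / c) * ((c * llr x - f x) + f x)" using c by simp
    also have "\<dots> \<le> (1 / c) * (max 0 (c * llr x - f x) + norm (f x))"
      using c by (intro mult_left_mono add_mono) auto
    finally have "ennreal (llr x) \<le> ennreal ((1 / c) * (max 0 (c * llr x - f x) + norm (f x)))"
      by (rule ennreal_leI)
    also have "\<dots> = ennreal (1 / c) * (ennreal (c * llr x - f x) + ennreal (norm (f x)))"
      using c by (simp only: ennreal_mult ennreal_plus ennreal_max_0 max.cobounded1 norm_ge_zero add_nonneg_nonneg zero_le_divide_1_iff less_imp_le)
    finally show ?case using elim by simp
  qed
  also have "\<dots> = ennreal (1 / c) * ((\<integral>\<^sup>+x. e2ennreal (gain p x) \<partial>P) + (\<integral>\<^sup>+x. ennreal (norm (f x)) \<partial>P))"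
    by (simp add: nn_integral_cmult nn_integral_add)
  finally have "(\<integral>\<^sup>+x. e2ennreal (gain p x) \<partial>P) = \<infinity>"
    using f by (auto simp: integrable_iff_bounded ennreal_mult_eq_top_iff top_unique)
  then show ?thesis
    using False c by (simp add: ext_expectation_def KL_eq)
qed

text \<open>Finiteness of the divergence keeps the positive part of every protocol's
  gain integrable, so the junk value of \<open>\<infinity> - \<infinity>\<close> cannot arise.\<close>
lemma ext_expectation_gain_finite:
  assumes llr: "integrable P llr" and q: "prob_density S q"
  shows "ext_expectation P (gain q) \<le> ext_expectation P (gain p)"
    and "ext_expectation P (gain q) = ext_expectation P (gain p) \<Longrightarrow> AE x in S. q x = p x"
proof -
  interpret P: prob_space P using p by (rule prob_density_prob_space)
  have prob_S: "P.prob (space S) = 1" using P.prob_space by simp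
  have [measurable]: "q \<in> borel_measurable S" and q_nn: "\<And>x. x \<in> space S \<Longrightarrow> 0 \<le> q x"
    using q by (auto simp: prob_density_def)
  have Ep: "ext_expectation P (gain p) = ereal (c * (\<integral>x. llr x \<partial>P) - (\<integral>x. f x \<partial>P))"
    using llr by (simp add: ext_expectation_gain_p KL_eq)
  \<comment> \<open>\<open>h\<close> is the real-valued gain, which may replace
    \<open>gain q\<close> only where \<open>q\<close> is positive because \<open>ln 0\<close> is 0;
    \<open>b\<close> is the log ratio to which Gibbs' inequality applies.\<close>
  define h where "h x = c * ln (q x / r x) - f x" for x
  define b where "b x = ln (q x / p x)" for x
  have [measurable]: "h \<in> borel_measurable S" "b \<in> borel_measurable S"
    unfolding h_def b_def by measurable
  \<comment> \<open>The majorant comes from ln (q / r) = ln (q / p) + ln (p / r) and ln t \<le> t.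
    Where \<open>q\<close> is 0 the gain is -\<infinity> and its positive part vanishes.\<close>
  have "(\<integral>\<^sup>+x. e2ennreal (gain q x) \<partial>P)
      \<le> (\<integral>\<^sup>+x. ennreal (norm (c * (q x / p x) + c * \<bar>llr x\<bar> + \<bar>f x\<bar>)) \<partial>P)"
    using AE_pos AE_space[of P]
  proof (intro nn_integral_mono_AE, eventually_elim)
    case (elim x)
    show ?case
    proof (cases "0 < q x")
      case True
      have "ln (q x / r x) = ln (q x / p x) + llr x"
        using elim True by (simp add: ln_div)
      also have "\<dots> \<le> q x / p x + \<bar>llr x\<bar>"
        using elim True by (intro add_mono ln_bound) auto
      finally have "c * ln (q x / r x) \<le> c * (q x / p x + \<bar>llr x\<bar>)"
        using c by (intro mult_left_mono) auto
      then have "h x \<le> norm (c * (q x / p x) + c * \<bar>llr x\<bar> + \<bar>f x\<bar>)"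
        by (auto simp: h_def distrib_left)
      moreover have "gain q x = ereal (h x)"
        using elim True by (simp add: h_def ext_ln_def)
      ultimately show ?thesis by (simp add: ennreal_leI del: real_norm_def)
    next
      case False
      with elim q_nn c show ?thesis
        by (simp add: ext_ln_def zero_less_divide_iff e2ennreal_neg)
    qed
  qed
  also have "\<dots> < \<infinity>"
  proof -
    have "integrable P (\<lambda>x. c * (q x / p x) + c * \<bar>llr x\<bar> + \<bar>f x\<bar>)"
      using integrable_ratio(1)[OF q] llr f
      by (intro Bochner_Integration.integrable_add integrable_mult_right integrable_abs)
    then show ?thesis by (simp only: integrable_iff_bounded)
  qed
  finally have pos: "(\<integral>\<^sup>+x. e2ennreal (gain q x) \<partial>P) < \<infinity>" .
  have *: "ext_expectation P (gain q) \<le> ext_expectation P (gain p) \<and>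
    (ext_expectation P (gain q) = ext_expectation P (gain p) \<longrightarrow> (AE x in S. q x = p x))"
  \<comment> \<open>An infinite negative part puts the mean at -\<infinity>, strictly below the
    finite optimum, so equality cannot occur in that case.\<close>
  proof (cases "(\<integral>\<^sup>+x. e2ennreal (- gain q x) \<partial>P) = \<infinity>")
    case True
    with pos have "ext_expectation P (gain q) = -\<infinity>"
      unfolding ext_expectation_def by (cases "\<integral>\<^sup>+x. e2ennreal (gain q x) \<partial>P") (auto simp: enn2ereal_ennreal)
    with Ep show ?thesis by simp
  next
    case False
    \<comment> \<open>A negative part of finite mean excludes the value -\<infinity>, so
      \<open>q\<close> is positive almost everywhere under \<open>P\<close>.\<close>
    then have "AE x in P. e2ennreal (- gain q x) \<noteq> \<infinity>"
      by (intro nn_integral_noteq_infinite) auto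
    with AE_pos AE_space have q_pos: "AE x in P. 0 < q x"
    proof eventually_elim
      case (elim x)
      with c show ?case
        by (cases "0 < q x") (auto simp: ext_ln_def zero_less_divide_iff)
    qed
    have gain_h: "AE x in P. gain q x = ereal (h x)"
      using q_pos AE_pos by eventually_elim (auto simp: h_def ext_ln_def)
    have "(\<integral>\<^sup>+x. e2ennreal (gain q x) \<partial>P) = (\<integral>\<^sup>+x. ennreal (h x) \<partial>P)"
      "(\<integral>\<^sup>+x. e2ennreal (- gain q x) \<partial>P) = (\<integral>\<^sup>+x. ennreal (- h x) \<partial>P)"
      using gain_h by (auto intro!: nn_integral_cong_AE)
    with pos False have h: "integrable P h"
      by (auto simp: real_integrable_def)
    \<comment> \<open>Expressing \<open>b\<close> through \<open>h\<close>, \<open>f\<close> and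
      \<open>llr\<close> yields its integrability from theirs.\<close>
    have "AE x in P. (h x + f x) / c - llr x = b x"
      using AE_pos q_pos by eventually_elim (use c in \<open>auto simp: h_def b_def ln_div field_simps\<close>)
    moreover have "integrable P (\<lambda>x. (h x + f x) / c - llr x)"
      using h f llr by auto
    ultimately have b: "integrable P b" and "(\<integral>x. (h x + f x) / c - llr x \<partial>P) = (\<integral>x. b x \<partial>P)"
      by (auto intro: integrable_cong_AE_imp integral_cong_AE)
    then have Eb: "((\<integral>x. h x \<partial>P) + (\<integral>x. f x \<partial>P)) / c - (\<integral>x. llr x \<partial>P) = (\<integral>x. b x \<partial>P)"
      using h f llr by simp
    have Eq: "ext_expectation P (gain q) = ereal (\<integral>x. h x \<partial>P)"
      using h gain_h by (rule ext_expectation_eq_integral)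
    \<comment> \<open>This is the defect in ln t \<le> t - 1 at t = \<open>q / p\<close>. Its
      nonnegative mean, with the mean of \<open>q / p\<close> at most 1, gives Gibbs'
      inequality.\<close>
    have nn: "AE x in P. 0 \<le> q x / p x - 1 - b x"
      using AE_pos q_pos
      by eventually_elim (use ln_le_minus_one in \<open>auto simp: b_def algebra_simps\<close>)
    have int: "integrable P (\<lambda>x. q x / p x - 1 - b x)"
      using b integrable_ratio(1)[OF q] by auto
    have le: "0 \<le> (\<integral>x. q x / p x \<partial>P) - 1 - (\<integral>x. b x \<partial>P)"
      using integral_nonneg_AE[OF nn] b integrable_ratio(1)[OF q] by (simp add: prob_S)
    have b0: "(\<integral>x. b x \<partial>P) \<le> 0"
      using le integrable_ratio(2)[OF q] by simp
    have Eh: "(\<integral>x. h x \<partial>P) = c * (\<integral>x. b x \<partial>P) + (c * (\<integral>x. llr x \<partial>P) - (\<integral>x. f x \<partial>P))"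
      using Eb c by (simp add: field_simps)
    show ?thesis
    proof (intro conjI impI)
      show "ext_expectation P (gain q) \<le> ext_expectation P (gain p)"
        unfolding Ep Eq Eh using b0 c by (simp add: mult_le_0_iff)
      assume "ext_expectation P (gain q) = ext_expectation P (gain p)"
      then have "(\<integral>x. b x \<partial>P) = 0"
        unfolding Ep Eq Eh using c by simp
      \<comment> \<open>If \<open>b\<close> has mean 0, the mean of \<open>q / p\<close> is squeezed
        to exactly 1, so the defect has mean 0 and vanishes almost everywhere, which forces t =
        1.\<close>
      with le integrable_ratio[OF q] b integral_nonneg_AE[OF nn]
      have "(\<integral>x. q x / p x - 1 - b x \<partial>P) = 0"
        by (simp add: prob_S)
      then have "AE x in P. q x / p x - 1 - b x = 0"
        using integral_nonneg_eq_0_iff_AE[OF int nn] by simp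
      with q_pos AE_pos have "AE x in P. q x = p x"
      proof eventually_elim
        case (elim x)
        then have "q x / p x = 1"
          by (intro ln_eq_minus_one) (auto simp: b_def)
        with elim show ?case by simp
      qed
      then have "AE x in S. 0 < p x \<longrightarrow> q x = p x"
        by (simp add: AE_density ennreal_less_zero_iff)
      with p q show "AE x in S. q x = p x"
        by (rule prob_density_eq_of_AE_eq_on_support)
    qed
  qed
  then show "ext_expectation P (gain q) \<le> ext_expectation P (gain p)"
    and "ext_expectation P (gain q) = ext_expectation P (gain p) \<Longrightarrow> AE x in S. q x = p x"
    by auto
qed

lemma ext_expectation_gain_le:
  assumes "prob_density S q"
  shows "ext_expectation P (gain q) \<le> ext_expectation P (gain p)"
proof (cases "integrable P llr")
  case True
  then show ?thesis using assms by (rule ext_expectation_gain_finite)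
next
  \<comment> \<open>An infinite divergence makes the right side \<infinity>.\<close>
  case False
  then show ?thesis using c by (simp add: ext_expectation_gain_p KL_eq)
qed

text \<open>With infinite divergence uniqueness fails: \<open>(p + r) / 2\<close> also attains
  \<infinity>, since its log ratio to \<open>r\<close> is at least \<open>llr\<close> - ln
  2.\<close>

lemma ext_expectation_gain_unique:
  assumes "KL P R \<noteq> \<infinity>" "prob_density S q"
    and "ext_expectation P (gain q) = ext_expectation P (gain p)"
  shows "AE x in S. q x = p x"
  using assms by (intro ext_expectation_gain_finite(2)) (auto simp: KL_eq split: if_splits)

lemma ext_expectation_gain_p_pos_iff:
  "0 < ext_expectation P (gain p) \<longleftrightarrow> ereal (\<integral>x. f x \<partial>P) < ereal c * KL P R"
  using c by (auto simp: ext_expectation_gain_p KL_eq)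

end

end

section \<open>Conditional densities for almost every measurement\<close>

context measured_engine
begin

text \<open>Under the law of \<open>Y\<close> almost every \<open>y\<close> has positive
  \<open>PY y\<close>; the slice of \<open>PXY\<close> integrates to that value, so dividing
  normalizes it. Domination holds because a joint density vanishes almost everywhere that its
  marginal does.\<close>

lemma AE_dominated_density:
  "AE y in distr M SY Y. dominated_density SX (cond_dens PXY PY y) PX"
proof -
  interpret XY: pair_sigma_finite SX SY ..
  have [measurable]: "PXY \<in> borel_measurable (SX \<Otimes>\<^sub>M SY)" "PX \<in> borel_measurable SX" "PY \<in> borel_measurable SY"
    using PXY PX PY PXY_nonneg PX_nonneg PY_nonneg
    by (auto intro!: distributed_real_measurable simp: space_pair_measure)
  have [measurable]: "X \<in> measurable M SX" "Y \<in> measurable M SY"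
    using PX PY by (auto dest: distributed_measurable)
  have PX_dens: "prob_density SX PX"
  proof -
    have "prob_space (distr M SX X)" by (intro prob_space_distr) auto
    then have "prob_space (density SX (\<lambda>x. ennreal (PX x)))"
      by (simp add: distributed_distr_eq_density[OF PX, symmetric])
    from prob_space.emeasure_space_1[OF this] show ?thesis
      by (simp add: prob_density_def PX_nonneg emeasure_density cong: nn_integral_cong)
  qed
  have "AE z in SX \<Otimes>\<^sub>M SY. PX (fst z) = 0 \<longrightarrow> PXY z = 0"
    by (rule subdensity_real[OF _ PXY PX])
      (auto simp: comp_def PXY_nonneg PX_nonneg space_pair_measure intro!: AE_I2)
  \<comment> \<open>A null set of the product measure has null slices at almost every
    \<open>y\<close>.\<close>
  then have "AE y in SY. AE x in SX. PX x = 0 \<longrightarrow> PXY (x, y) = 0"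
    by (subst XY.AE_commute[symmetric], measurable) (drule XY.AE_pair, simp)
  moreover have "AE y in SY. ennreal (PY y) = (\<integral>\<^sup>+x. ennreal (PXY (x, y)) \<partial>SX)"
    by (rule distributed_marginal_eq_joint2[OF _ _ PY PXY]) unfold_locales
  ultimately have "AE y in SY. 0 < ennreal (PY y) \<longrightarrow> dominated_density SX (cond_dens PXY PY y) PX"
    using AE_space
  proof eventually_elim
    case (elim y)
    note [measurable] = \<open>y \<in> space SY\<close>
    show ?case
    proof
      assume "0 < ennreal (PY y)"
      then have pos: "0 < PY y" by (simp add: ennreal_less_zero_iff)
      have "(\<integral>\<^sup>+x. ennreal (PXY (x, y) / PY y) \<partial>SX) = (\<integral>\<^sup>+x. ennreal (PXY (x, y)) / ennreal (PY y) \<partial>SX)"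
        using pos \<open>y \<in> space SY\<close> by (intro nn_integral_cong) (simp add: divide_ennreal PXY_nonneg)
      also have "\<dots> = 1"
        using pos elim by (simp add: nn_integral_divide flip: elim(2))
      finally have "prob_density SX (cond_dens PXY PY y)"
        using pos \<open>y \<in> space SY\<close> PXY_nonneg by (auto simp: prob_density_def cond_dens_def[abs_def])
      moreover have "AE x in SX. PX x = 0 \<longrightarrow> cond_dens PXY PY y x = 0"
        using elim(1) by eventually_elim (simp add: cond_dens_def)
      ultimately show "dominated_density SX (cond_dens PXY PY y) PX"
        using PX_dens by unfold_locales auto
    qed
  qed
  then show ?thesis
    unfolding distributed_distr_eq_density[OF PY] by (subst AE_density) auto
qed

end

section \<open>An exactly measured uniform bit\<close>

definition demon_joint :: "bool \<times> bool \<Rightarrow> real" where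
  "demon_joint = (\<lambda>(x, y). if x = y then 1 / 2 else 0)"

text \<open>The sample point is the pair of state and measurement itself, so \<open>fst\<close> and
  \<open>snd\<close> serve as \<open>X\<close> and \<open>Y\<close>.\<close>

definition demon_space :: "(bool \<times> bool) measure" where
  "demon_space = density (count_space UNIV) (\<lambda>z. ennreal (demon_joint z))"

lemma space_demon_space: "space demon_space = UNIV"
  by (simp add: demon_space_def)

lemma emeasure_demon_space:
  "emeasure demon_space A =
     ennreal ((if (False, False) \<in> A then 1 / 2 else 0) + (if (True, True) \<in> A then 1 / 2 else 0))"
proof -
  have "emeasure demon_space A = (\<Sum>z\<in>UNIV. ennreal (demon_joint z) * indicator A z)"
    by (simp add: demon_space_def emeasure_density nn_integral_count_space_finite)
  also have "\<dots> = (\<Sum>z\<in>UNIV. ennreal (demon_joint z * indicator A z))"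
    by (intro sum.cong) (auto simp: indicator_def)
  also have "\<dots> = ennreal (\<Sum>z\<in>UNIV. demon_joint z * indicator A z)"
    by (intro sum_ennreal) (auto simp: demon_joint_def)
  also have "(\<Sum>z\<in>UNIV. demon_joint z * indicator A z)
      = (\<Sum>x\<in>UNIV. \<Sum>y\<in>UNIV. demon_joint (x, y) * indicator A (x, y))"
    unfolding sum.cartesian_product by (intro sum.cong) auto
  also have "\<dots> = (if (False, False) \<in> A then 1 / 2 else 0) + (if (True, True) \<in> A then 1 / 2 else 0)"
    by (simp add: UNIV_bool demon_joint_def indicator_def)
  finally show ?thesis .
qed

lemma measured_engine_demon:
  "measured_engine demon_space (count_space UNIV) (count_space UNIV) fst snd
     demon_joint (\<lambda>_. 1 / 2) (\<lambda>_. 1 / 2)"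
proof -
  have sets_demon [measurable_cong]: "sets demon_space = sets (count_space UNIV)"
    by (simp add: demon_space_def)
  have marginal: "distr demon_space (count_space UNIV) g = density (count_space UNIV) (\<lambda>_. ennreal (1 / 2))"
    if "g = fst \<or> g = snd" for g :: "bool \<times> bool \<Rightarrow> bool"
  proof (rule measure_eqI_finite[where A=UNIV])
    fix b :: bool
    show "emeasure (distr demon_space (count_space UNIV) g) {b} =
        emeasure (density (count_space UNIV) (\<lambda>_. ennreal (1 / 2))) {b}"
    proof -
      have "emeasure (distr demon_space (count_space UNIV) g) {b} = emeasure demon_space {z. g z = b}"
        by (subst emeasure_distr) (auto simp: space_demon_space vimage_def)
      also have "\<dots> = ennreal (1 / 2)"
        using that by (cases b) (auto simp: emeasure_demon_space)
      also have "\<dots> = emeasure (density (count_space UNIV) (\<lambda>_. ennreal (1 / 2))) {b}"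
        by (subst emeasure_density) (auto simp: nn_integral_cmult_indicator)
      finally show ?thesis .
    qed
  qed (simp_all add: demon_space_def)
  \<comment> \<open>This makes \<open>demon_joint\<close> a density for the product reference
    measure; the pair variable is then the identity on \<open>demon_space\<close>.\<close>
  have pair: "count_space UNIV \<Otimes>\<^sub>M count_space UNIV = (count_space UNIV :: (bool \<times> bool) measure)"
    using pair_measure_countable[of "UNIV :: bool set" "UNIV :: bool set"] by auto
  interpret demon: prob_space demon_space
  proof
    show "emeasure demon_space (space demon_space) = 1"
      unfolding emeasure_demon_space space_demon_space by simp
  qed
  show ?thesis
  proof (intro measured_engine.intro measured_engine_axioms.intro demon.prob_space_axioms
      sigma_finite_measure_count_space)
    show "distributed demon_space (count_space UNIV \<Otimes>\<^sub>M count_space UNIV) (\<lambda>\<omega>. (fst \<omega>, snd \<omega>)) demon_joint"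
      unfolding pair distributed_def using distr_id2[OF sets_demon[symmetric]]
      by (auto simp: demon_space_def[symmetric] measurable_def space_demon_space sets_demon)
    show "distributed demon_space (count_space UNIV) fst (\<lambda>_. ennreal (1 / 2))"
      "distributed demon_space (count_space UNIV) snd (\<lambda>_. ennreal (1 / 2))"
      using marginal[of fst] marginal[of snd]
      by (simp_all add: distributed_def measurable_def space_demon_space sets_demon)
  qed (auto simp: demon_joint_def)
qed

lemma cond_law_demon:
  "cond_law (count_space UNIV) demon_joint (\<lambda>_. 1 / 2) y
     = density (count_space UNIV) (\<lambda>x. if x = y then 1 else 0)"
  by (auto simp: cond_law_def cond_dens_def demon_joint_def intro!: arg_cong[where f="density _"])

text \<open>Given \<open>y\<close> the state is \<open>y\<close> with certainty. The sign of
  \<open>g y y\<close> decides which part can be nonzero, so \<infinity> - \<infinity> does not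
  arise even for infinite values.\<close>

lemma cond_expect_demon:
  "cond_expect (count_space UNIV) demon_joint (\<lambda>_. 1 / 2) g y = g y y"
proof -
  have *: "(\<integral>\<^sup>+x. h x \<partial>density (count_space UNIV) (\<lambda>x. if x = y then 1 else 0)) = h y" for h :: "bool \<Rightarrow> ennreal"
    by (cases y) (simp_all add: nn_integral_density nn_integral_count_space_finite UNIV_bool)
  show ?thesis
    unfolding cond_expect_def ext_expectation_def cond_law_demon *
    by (cases "g y y" "0 :: ereal" rule: linorder_le_cases)
      (auto simp: enn2ereal_e2ennreal e2ennreal_neg zero_ennreal.rep_eq)
qed

text \<open>A probability mass is at most 1, so its ratio to the prior mass 1/2 is at most
  2.\<close>

lemma work_demon_le:
  fixes Q :: "bool \<Rightarrow> bool \<Rightarrow> real"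
  assumes c: "0 < k\<^sub>B * T" and Q: "prob_density (count_space UNIV) (Q y)"
  shows "work k\<^sub>B T (\<lambda>_. 1 / 2) f Q y y \<le> ereal (k\<^sub>B * T * ln 2 - f y)"
proof -
  have "ennreal (Q y y) \<le> (\<Sum>x\<in>UNIV. ennreal (Q y x))"
    by (rule member_le_sum) auto
  also have "\<dots> = 1"
    using Q by (simp add: prob_density_def nn_integral_count_space_finite)
  finally have "Q y y \<le> 1" by (simp add: ennreal_le_1)
  then show ?thesis
    using c by (auto simp: work_def ext_ln_def ln_mult intro!: mult_left_mono)
qed

text \<open>The example gives content to the word "may": idling beats every protocol at one result
  and loses at another, and both results have positive probability, so neither hides in a null
  set.\<close>

theorem mainTheorem5:
  fixes M :: "'a measure" and SX :: "'x measure" and SY :: "'y measure"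
    and X :: "'a \<Rightarrow> 'x" and Y :: "'a \<Rightarrow> 'y"
    and PXY :: "'x \<times> 'y \<Rightarrow> real" and PX :: "'x \<Rightarrow> real" and PY :: "'y \<Rightarrow> real"
    and f :: "'x \<Rightarrow> real" and k\<^sub>B T :: real
  assumes engine: "measured_engine M SX SY X Y PXY PX PY"
    and f: "f \<in> borel_measurable SX"
    and k\<^sub>B: "0 < k\<^sub>B" and T: "0 < T"
  shows
    "(AE y in distr M SY Y.
       prob_density SX (cond_dens PXY PY y) \<and>
       (integrable (cond_law SX PXY PY y) f \<longrightarrow>
         (let EW = (\<lambda>Q. cond_expect SX PXY PY (work k\<^sub>B T PX f Q) y);
              Eidle = cond_expect SX PXY PY (\<lambda>_ _. 0) y;
              Qopt = cond_dens PXY PY;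
              D = KL (cond_law SX PXY PY y) (density SX PX);
              Ef = ereal (\<integral>x. f x \<partial>cond_law SX PXY PY y)
          in (\<forall>Q. prob_density SX (Q y) \<longrightarrow> EW Q \<le> EW Qopt) \<and>
             (D \<noteq> \<infinity> \<longrightarrow>
                (\<forall>Q. prob_density SX (Q y) \<and> EW Q = EW Qopt \<longrightarrow> (AE x in SX. Q y x = Qopt y x))) \<and>
             EW Qopt = ereal (k\<^sub>B * T) * D - Ef \<and>
             ((\<exists>Q. prob_density SX (Q y) \<and> Eidle < EW Q) \<longleftrightarrow> Ef < ereal (k\<^sub>B * T) * D))))
     \<and>
     (\<exists>(M' :: (bool \<times> bool) measure) (SX' :: bool measure) (SY' :: bool measure)
        X' Y' PXY' PX' PY' (f' :: bool \<Rightarrow> real) y0 y1.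
       measured_engine M' SX' SY' X' Y' PXY' PX' PY' \<and>
       f' \<in> borel_measurable SX' \<and> (\<forall>x. 0 \<le> f' x) \<and>
       0 < measure M' {\<omega> \<in> space M'. Y' \<omega> = y0} \<and>
       0 < measure M' {\<omega> \<in> space M'. Y' \<omega> = y1} \<and>
       (\<forall>Q. prob_density SX' (Q y0) \<longrightarrow>
          cond_expect SX' PXY' PY' (work k\<^sub>B T PX' f' Q) y0 < cond_expect SX' PXY' PY' (\<lambda>_ _. 0) y0) \<and>
       cond_expect SX' PXY' PY' (\<lambda>_ _. 0) y1
         < cond_expect SX' PXY' PY' (work k\<^sub>B T PX' f' (cond_dens PXY' PY')) y1)"
proof (intro conjI, goal_cases)
  case 1
  interpret measured_engine M SX SY X Y PXY PX PY by (rule engine)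
  have kT: "0 < k\<^sub>B * T" using k\<^sub>B T by simp
  show ?case
    using AE_dominated_density
  proof eventually_elim
    case (elim y)
    interpret dominated_density SX "cond_dens PXY PY y" PX by (rule elim)
    have law: "cond_law SX PXY PY y = P" by (simp add: cond_law_def)
    have EW: "cond_expect SX PXY PY (work k\<^sub>B T PX f Q) y = ext_expectation P
        (\<lambda>x. ereal (k\<^sub>B * T) * ext_ln (Q y x / PX x) - ereal (f x))" for Q
      by (simp add: cond_expect_def law work_def)
    have Eidle: "cond_expect SX PXY PY (\<lambda>_ _. 0) y = 0"
      by (simp add: cond_expect_def ext_expectation_zero)
    show ?case
      unfolding Let_def EW Eidle law
    proof (intro conjI impI allI p)
      assume int: "integrable P f"
      note gain_le = ext_expectation_gain_le[OF kT int]
      show "ext_expectation P (gain (k\<^sub>B * T) f (Q y))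
          \<le> ext_expectation P (gain (k\<^sub>B * T) f (cond_dens PXY PY y))"
        if "prob_density SX (Q y)" for Q
        using that by (rule gain_le)
      show "AE x in SX. Q y x = cond_dens PXY PY y x"
        if "KL P R \<noteq> \<infinity>" "prob_density SX (Q y) \<and>
          ext_expectation P (gain (k\<^sub>B * T) f (Q y))
            = ext_expectation P (gain (k\<^sub>B * T) f (cond_dens PXY PY y))" for Q
        using that by (intro ext_expectation_gain_unique[OF kT int]) auto
      show "ext_expectation P (gain (k\<^sub>B * T) f (cond_dens PXY PY y))
          = ereal (k\<^sub>B * T) * KL P R - ereal (\<integral>x. f x \<partial>P)"
        by (rule ext_expectation_gain_p[OF kT int])
      \<comment> \<open>Idling yields 0, and the optimal protocol is itself admissible and bounds
        all others, so the choice between cycle and no cycle reduces to the sign of the optimal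
        gain.\<close>
      have "(\<exists>Q. prob_density SX (Q y) \<and> 0 < ext_expectation P (gain (k\<^sub>B * T) f (Q y)))
          \<longleftrightarrow> 0 < ext_expectation P (gain (k\<^sub>B * T) f (cond_dens PXY PY y))"
        using p gain_le by (meson less_le_trans)
      then show "(\<exists>Q. prob_density SX (Q y) \<and> 0 < ext_expectation P (gain (k\<^sub>B * T) f (Q y)))
          \<longleftrightarrow> ereal (\<integral>x. f x \<partial>P) < ereal (k\<^sub>B * T) * KL P R"
        using ext_expectation_gain_p_pos_iff[OF kT int] by simp
    qed
  qed
next
  case 2
  have c: "0 < k\<^sub>B * T" using k\<^sub>B T by simp
  \<comment> \<open>Twice the bound of \<open>work_demon_le\<close> leaves every protocol at most
    -\<open>k\<^sub>B * T * ln 2\<close> when \<open>False\<close> is measured.\<close>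
  define loss where "loss b = (if b then 0 else 2 * (k\<^sub>B * T * ln 2))" for b
  have prob: "0 < measure demon_space {\<omega> \<in> space demon_space. snd \<omega> = b}" for b
  proof -
    have "emeasure demon_space {\<omega> \<in> space demon_space. snd \<omega> = b} = ennreal (1 / 2)"
      by (cases b) (simp_all add: emeasure_demon_space space_demon_space)
    then have "measure demon_space {\<omega> \<in> space demon_space. snd \<omega> = b} = 1 / 2"
      by (rule measure_eq_emeasure_eq_ennreal[rotated]) simp
    then show ?thesis by simp
  qed
  show ?case
  proof (intro exI conjI)
    show "measured_engine demon_space (count_space UNIV) (count_space UNIV) fst snd
        demon_joint (\<lambda>_. 1 / 2) (\<lambda>_. 1 / 2)"
      by (rule measured_engine_demon)
    show "loss \<in> borel_measurable (count_space UNIV)" by simp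
    show "\<forall>x. 0 \<le> loss x" using c by (simp add: loss_def)
    show "0 < measure demon_space {\<omega> \<in> space demon_space. snd \<omega> = False}"
      "0 < measure demon_space {\<omega> \<in> space demon_space. snd \<omega> = True}"
      by (rule prob)+
    show "\<forall>Q. prob_density (count_space UNIV) (Q False) \<longrightarrow>
        cond_expect (count_space UNIV) demon_joint (\<lambda>_. 1 / 2) (work k\<^sub>B T (\<lambda>_. 1 / 2) loss Q) False
        < cond_expect (count_space UNIV) demon_joint (\<lambda>_. 1 / 2) (\<lambda>_ _. 0) False"
    proof (intro allI impI)
      fix Q :: "bool \<Rightarrow> bool \<Rightarrow> real"
      assume "prob_density (count_space UNIV) (Q False)"
      from work_demon_le[where Q=Q and y=False and f=loss, OF c this]
      have "work k\<^sub>B T (\<lambda>_. 1 / 2) loss Q False False \<le> ereal (- (T * (k\<^sub>B * ln 2)))"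
        by (simp add: loss_def mult_ac)
      also have "\<dots> < 0" using k\<^sub>B T by simp
      finally show "cond_expect (count_space UNIV) demon_joint (\<lambda>_. 1 / 2) (work k\<^sub>B T (\<lambda>_. 1 / 2) loss Q) False
        < cond_expect (count_space UNIV) demon_joint (\<lambda>_. 1 / 2) (\<lambda>_ _. 0) False"
        by (simp add: cond_expect_demon)
    qed
    \<comment> \<open>At \<open>True\<close> there is no loss, and the ratio 1 / (1/2) = 2 earns
      \<open>k\<^sub>B * T * ln 2\<close>.\<close>
    show "cond_expect (count_space UNIV) demon_joint (\<lambda>_. 1 / 2) (\<lambda>_ _. 0) True
        < cond_expect (count_space UNIV) demon_joint (\<lambda>_. 1 / 2)
            (work k\<^sub>B T (\<lambda>_. 1 / 2) loss (cond_dens demon_joint (\<lambda>_. 1 / 2))) True"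
      using c unfolding cond_expect_demon by (simp add: work_def cond_dens_def demon_joint_def loss_def ext_ln_def)
  qed
qed

end
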